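(* The following hold. (i) Let $\mathcal{K}=\mathcal{K}^1\times\mathcal{K}^2$, where $\mathcal{K}^1\subseteq\mathcal{E}^1$ and $\mathcal{K}^2\subseteq\mathcal{E}^2$ are amenable pointed closed convex cones. Let $\mathcal{F}$ be a face of $\mathcal{K}$ and $z\in\mathcal{F}^*$. Write $\mathcal{F}=\mathcal{F}^1\times\mathcal{F}^2$ with $\mathcal{F}^i$ a face of $\mathcal{K}^i$, and $z=(z_1,z_2)$ with $z_i\in(\mathcal{F}^i)^*$, $i=1,2$. Let $\psi_{\mathcal{F}^1,z_1}$ and $\psi_{\mathcal{F}^2,z_2}$ be facial residual functions for $\mathcal{F}^1,z_1$ (with respect to $\mathcal{K}^1$) and for $\mathcal{F}^2,z_2$ (with respect to $\mathcal{K}^2$), respectively. Then there is a positive rescaling of $\psi_{\mathcal{F}^1,z_1}+\psi_{\mathcal{F}^2,z_2}$ that is a facial residual function for $\mathcal{F},z$ (with respect to $\mathcal{K}$). (ii) Let $\mathcal{K}\subseteq\mathcal{E}$ be a pointed closed convex cone and let $\mathcal{A}:\mathcal{E}\to\mathcal{E}'$ be an injective linear map. Let $\mathcal{F}$ be a face of $\mathcal{K}$, so that $\mathcal{A}(\mathcal{F})$ is a face of $\mathcal{A}(\mathcal{K})$, and let $z\in(\mathcal{A}(\mathcal{F}))^*$. Let $\psi_{\mathcal{F},\mathcal{A}^\top z}$ be a facial residual function for $\mathcal{F},\mathcal{A}^\top z$ (with respect to $\mathcal{K}$). Then there is a positive rescaling of $\psi_{\mathcal{F},\mathcal{A}^\top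 z}$ that is a facial residual function for $\mathcal{A}(\mathcal{F}),z$ (with respect to $\mathcal{A}(\mathcal{K})$).
   Context: $\mathcal{E},\mathcal{E}',\mathcal{E}^1,\mathcal{E}^2$ are finite-dimensional real inner product spaces; $\mathcal{E}^1\times\mathcal{E}^2$ carries the inner product $\langle(x_1,x_2),(y_1,y_2)\rangle=\langle x_1,y_1\rangle+\langle x_2,y_2\rangle$. Norms are induced by the inner products and $\operatorname{dist}(x,C)=\inf\{\|x-y\|: y\in C\}$. $\mathcal{A}^\top$ is the adjoint. A convex cone is a nonempty set closed under nonnegative linear combinations; it is pointed if $\mathcal{K}\cap-\mathcal{K}=\{0\}$. A face of $\mathcal{K}$ is a convex cone $\mathcal{F}\subseteq\mathcal{K}$ such that $x,y\in\mathcal{K}$, $x+y\in\mathcal{F}$ imply $x,y\in\mathcal{F}$. $C^*=\{x:\langle x,y\rangle\ge0\ \forall y\in C\}$; $\{z\}^\perp$ is the set of vectors orthogonal to $z$. A closed convex cone $\mathcal{K}$ is amenable if for every face $\mathcal{F}$ of $\mathcal{K}$ there is $\kappa>0$ such that $\operatorname{dist}(x,\mathcal{F})\le\kappa\operatorname{dist}(x,\mathcal{K})$ for all $x\in\operatorname{span}\mathcal{F}$. Facial residual function: let $\mathcal{F}$ be a face of a closed convex cone $\mathcal{K}$, $z\in\mathcal{F}^*$, $\hat{\mathcal{F}}=\mathcal{F}\cap\{z\}^\perp$. A function $\psi_{\mathcal{F},z}:\mathbb{R}_+\times\mathbb{R}_+\to\mathbb{R}_+$ is a facial residual function for $\mathcal{F}$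 and $z$ (with respect to $\mathcal{K}$) if (1) it is nonnegative, monotone nondecreasing in each argument, and $\psi_{\mathcal{F},z}(0,\alpha)=0$ for all $\alpha\ge0$; (2) whenever $x\in\operatorname{span}\mathcal{K}$ and $\epsilon\ge 0$ satisfy $\operatorname{dist}(x,\mathcal{K})\le\epsilon$, $\langle x,z\rangle\le\epsilon$, $\operatorname{dist}(x,\operatorname{span}\mathcal{F})\le\epsilon$, we have $\operatorname{dist}(x,\hat{\mathcal{F}})\le\psi_{\mathcal{F},z}(\epsilon,\|x\|)$. A positive rescaling of $\psi$ is a function of the form $(\epsilon,t)\mapsto M_3\,\psi(M_1\epsilon,M_2t)$ with constants $M_1,M_2,M_3>0$. *)

theory Defs
  imports "HOL-Analysis.Analysis"
begin

definition dual_cone :: "'a::real_inner set \<Rightarrow> 'a set" where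
  "dual_cone C = {x. \<forall>y\<in>C. 0 \<le> x \<bullet> y}"

definition pointed :: "'a::real_vector set \<Rightarrow> bool" where
  "pointed K \<longleftrightarrow> K \<inter> uminus ` K = {0}"

text \<open>
  Unlike the library's \<open>face_of\<close>, faces here are themselves convex cones, hence nonempty.
\<close>

definition cone_face :: "'a::real_vector set \<Rightarrow> 'a set \<Rightarrow> bool" where
  "cone_face F K \<longleftrightarrow> convex_cone F \<and> F \<subseteq> K \<and>
     (\<forall>x\<in>K. \<forall>y\<in>K. x + y \<in> F \<longrightarrow> x \<in> F \<and> y \<in> F)"

lemma cone_face_iff_face_of:
  assumes K: "convex_cone K"
  shows "cone_face F K \<longleftrightarrow> convex_cone F \<and> F face_of K"
proof
  assume F: "cone_face F K"
  have "a \<in> F \<and> b \<in> F"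
    if ab: "a \<in> K" "b \<in> K" and x: "x \<in> F" "x \<in> open_segment a b" for a b x
  proof -
    obtain u where u: "0 < u" "u < 1" "x = (1 - u) *\<^sub>R a + u *\<^sub>R b"
      using x(2) by (auto simp: in_segment)
    have "(1 - u) *\<^sub>R a \<in> K" "u *\<^sub>R b \<in> K"
      using K ab u by (auto simp: convex_cone_def conic_def)
    then have "(1 - u) *\<^sub>R a \<in> F" "u *\<^sub>R b \<in> F"
      using F x(1) u(3) by (auto simp: cone_face_def)
    moreover have "conic F"
      using F by (simp add: cone_face_def convex_cone_def)
    ultimately have "inverse (1 - u) *\<^sub>R (1 - u) *\<^sub>R a \<in> F" "inverse u *\<^sub>R u *\<^sub>R b \<in> F"
      using u(1,2) by (simp_all only: conicD inverse_nonnegative_iff_nonnegative diff_ge_0_iff_ge less_imp_le)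
    then show ?thesis using u by simp
  qed
  then show "convex_cone F \<and> F face_of K"
    using F unfolding cone_face_def face_of_def convex_cone_def by blast
next
  assume F: "convex_cone F \<and> F face_of K"
  have "x \<in> F \<and> y \<in> F" if xy: "x \<in> K" "y \<in> K" "x + y \<in> F" for x y
  proof (cases "x = y")
    case True
    then have "(1/2::real) *\<^sub>R (x + y) = x"
      using scaleR_half_double[of x] by (simp only:)
    moreover have "(1/2::real) *\<^sub>R (x + y) \<in> F"
      using F xy(3) by (auto simp: convex_cone_def conic_def)
    ultimately show ?thesis using True by simp
  next
    case False
    have "(1/2::real) *\<^sub>R (x + y) \<in> F"
      using F xy(3) by (auto simp: convex_cone_def conic_def)
    moreover have "(1/2::real) *\<^sub>R (x + y) \<in> open_segment x y"
      using midpoint_in_open_segment[of x y] False by (simp add: midpoint_def)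
    ultimately show ?thesis
      using F xy(1,2) unfolding face_of_def by blast
  qed
  then show "cone_face F K"
    using F unfolding cone_face_def face_of_def by blast
qed

definition amenable :: "'a::real_inner set \<Rightarrow> bool" where
  "amenable K \<longleftrightarrow> closed K \<and> convex_cone K \<and>
     (\<forall>F. cone_face F K \<longrightarrow> (\<exists>\<kappa>>0. \<forall>x\<in>span F. infdist x F \<le> \<kappa> * infdist x K))"

text \<open>
  A function from pairs of nonnegative reals to nonnegative reals is represented by a curried
  function on all reals; only its values at nonnegative arguments are constrained.
\<close>

definition facial_residual_function ::
  "'a::real_inner set \<Rightarrow> 'a set \<Rightarrow> 'a \<Rightarrow> (real \<Rightarrow> real \<Rightarrow> real) \<Rightarrow> bool" where
  "facial_residual_function K F z \<psi> \<longleftrightarrow>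
     closed K \<and> convex_cone K \<and> cone_face F K \<and> z \<in> dual_cone F \<and>
     (\<forall>\<epsilon>\<ge>0. \<forall>t\<ge>0. 0 \<le> \<psi> \<epsilon> t) \<and>
     (\<forall>\<epsilon> \<epsilon>' t. 0 \<le> \<epsilon> \<and> \<epsilon> \<le> \<epsilon>' \<and> 0 \<le> t \<longrightarrow> \<psi> \<epsilon> t \<le> \<psi> \<epsilon>' t) \<and>
     (\<forall>\<epsilon> t t'. 0 \<le> \<epsilon> \<and> 0 \<le> t \<and> t \<le> t' \<longrightarrow> \<psi> \<epsilon> t \<le> \<psi> \<epsilon> t') \<and>
     (\<forall>t\<ge>0. \<psi> 0 t = 0) \<and>
     (\<forall>x\<in>span K. \<forall>\<epsilon>\<ge>0.
        infdist x K \<le> \<epsilon> \<and> x \<bullet> z \<le> \<epsilon> \<and> infdist x (span F) \<le> \<epsilon> \<longrightarrow>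
        infdist x (F \<inter> {z}\<^sup>\<bottom>) \<le> \<psi> \<epsilon> (norm x))"

definition positive_rescaling ::
  "(real \<Rightarrow> real \<Rightarrow> real) \<Rightarrow> (real \<Rightarrow> real \<Rightarrow> real) \<Rightarrow> bool" where
  "positive_rescaling \<psi> \<phi> \<longleftrightarrow>
     (\<exists>M1>0. \<exists>M2>0. \<exists>M3>0. \<phi> = (\<lambda>\<epsilon> t. M3 * \<psi> (M1 * \<epsilon>) (M2 * t)))"

end

theory Submission
  imports Defs
begin

text \<open>
  (i) All conditions on $x = (x_1, x_2)$ pass to the components except the bound on
  $\langle x_i, z_i\rangle$, which needs a lower bound on the other component's inner product.
  Amenability gives one: it bounds the distance of a point from $\mathcal{F}^i$ by its distances
  from $\mathcal{K}^i$ and from the span of $\mathcal{F}^i$, and an element of the dual cone cannot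
  be more negative at a point than its norm times the distance of the point from $\mathcal{F}^i$.

  (ii) An injective linear map between finite-dimensional spaces is bi-Lipschitz onto its image,
  so all distances change at most by constant factors.
\<close>

section \<open>Distances\<close>

lemma le_infdist:
  assumes "S \<noteq> {}" "\<And>y. y \<in> S \<Longrightarrow> c \<le> dist x y"
  shows "c \<le> infdist x S"
  using assms by (auto simp: infdist_notempty intro: cINF_greatest)

text \<open>Each \<open>y\<close> in \<open>S\<close> yields the competitor \<open>f y\<close> in
  \<open>T\<close>, and the infimum over \<open>y\<close> gives the bound. Asking only for an
  inclusion into \<open>T\<close> lets the rule serve for projections and for faces cut by a
  hyperplane.\<close>

lemma infdist_lipschitz_image_le:
  assumes "S \<noteq> {}" "f ` S \<subseteq> T" "0 < C"
    and "\<And>y. y \<in> S \<Longrightarrow> dist (f x) (f y) \<le> C * dist x y"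
  shows "infdist (f x) T \<le> C * infdist x S"
proof -
  have "infdist (f x) T / C \<le> infdist x S"
  proof (rule le_infdist[OF assms(1)])
    fix y assume y: "y \<in> S"
    then have "infdist (f x) T \<le> dist (f x) (f y)"
      using assms(2) by (intro infdist_le) auto
    also have "\<dots> \<le> C * dist x y"
      by (rule assms(4)[OF y])
    finally show "infdist (f x) T / C \<le> dist x y"
      using assms(3) by (simp add: field_simps)
  qed
  then show ?thesis
    using assms(3) by (simp add: field_simps)
qed

lemma infdist_fst_le:
  assumes "S \<noteq> {}" "fst ` S \<subseteq> T"
  shows "infdist (fst x) T \<le> infdist x S"
  using infdist_lipschitz_image_le[of S fst T 1 x] assms by (simp add: dist_fst_le)

lemma infdist_snd_le:
  assumes "S \<noteq> {}" "snd ` S \<subseteq> T"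
  shows "infdist (snd x) T \<le> infdist x S"
  using infdist_lipschitz_image_le[of S snd T 1 x] assms by (simp add: dist_snd_le)

text \<open>The product norm is at most the sum of the component norms. The infima need not be
  attained, so they are taken one after the other: first over \<open>t\<close> with \<open>s\<close>
  fixed, then over \<open>s\<close>.\<close>

lemma infdist_Times_le:
  fixes S :: "'a::metric_space set" and T :: "'b::metric_space set"
  assumes "S \<noteq> {}" "T \<noteq> {}"
  shows "infdist (a, b) (S \<times> T) \<le> infdist a S + infdist b T"
proof -
  have "infdist (a, b) (S \<times> T) - infdist b T \<le> infdist a S"
  proof (rule le_infdist[OF assms(1)])
    fix s assume s: "s \<in> S"
    have "infdist (a, b) (S \<times> T) - dist a s \<le> infdist b T"
    proof (rule le_infdist[OF assms(2)])
      fix t assume t: "t \<in> T"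
      have "infdist (a, b) (S \<times> T) \<le> dist (a, b) (s, t)"
        using s t by (intro infdist_le) simp
      also have "\<dots> \<le> dist a s + dist b t"
        unfolding dist_Pair_Pair by (rule sqrt_sum_squares_le_sum) auto
      finally show "infdist (a, b) (S \<times> T) - dist a s \<le> dist b t" by simp
    qed
    then show "infdist (a, b) (S \<times> T) - infdist b T \<le> dist a s" by simp
  qed
  then show ?thesis by simp
qed

text \<open>For \<open>y\<close> in \<open>F\<close>, \<open>x \<bullet> z\<close> equals
  \<open>y \<bullet> z - (y - x) \<bullet> z\<close>; the first term is nonnegative and
  Cauchy-Schwarz controls the second. The infimum over \<open>y\<close> is taken after dividing by
  \<open>norm z\<close>, hence the case split.\<close>

lemma dual_cone_inner_ge:
  assumes z: "z \<in> dual_cone F" and F: "F \<noteq> {}"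
  shows "- norm z * infdist x F \<le> x \<bullet> z"
proof (cases "z = 0")
  case False
  have "- (x \<bullet> z) / norm z \<le> infdist x F"
  proof (rule le_infdist[OF F])
    fix y assume "y \<in> F"
    then have "0 \<le> z \<bullet> y"
      using z by (simp add: dual_cone_def)
    moreover have "(y - x) \<bullet> z \<le> norm (y - x) * norm z"
      by (rule norm_cauchy_schwarz)
    ultimately show "- (x \<bullet> z) / norm z \<le> dist x y"
      using False
      by (simp add: field_simps inner_diff_left inner_diff_right inner_commute dist_norm norm_minus_commute)
  qed
  then show ?thesis
    using False by (simp add: field_simps)
qed simp

text \<open>Amenability speaks only of points of \<open>span F\<close>. The bound extends to every
  \<open>x\<close> by comparison with a point \<open>y\<close> of \<open>span F\<close>: since
  distance functions are 1-Lipschitz, the move costs \<open>dist x y\<close> for \<open>F\<close>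
  and \<kappa> times as much for \<open>K\<close>.\<close>

lemma amenable_infdist_face_le:
  assumes K: "amenable K" and F: "cone_face F K"
  obtains \<kappa> where "0 < \<kappa>"
    "\<And>x. infdist x F \<le> \<kappa> * infdist x K + (\<kappa> + 1) * infdist x (span F)"
proof -
  obtain \<kappa> where \<kappa>: "0 < \<kappa>" "\<And>y. y \<in> span F \<Longrightarrow> infdist y F \<le> \<kappa> * infdist y K"
    using K F unfolding amenable_def by blast
  have "infdist x F \<le> \<kappa> * infdist x K + (\<kappa> + 1) * infdist x (span F)" for x
  proof -
    \<comment> \<open>Solving for \<open>dist x y\<close> makes the left side independent of
      \<open>y\<close>, so the infimum over \<open>span F\<close> can be taken.\<close>
    have "(infdist x F - \<kappa> * infdist x K) / (\<kappa> + 1) \<le> infdist x (span F)"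
    proof (rule le_infdist)
      fix y assume "y \<in> span F"
      then have "infdist y F \<le> \<kappa> * infdist y K"
        by (rule \<kappa>(2))
      also have "\<dots> \<le> \<kappa> * (infdist x K + dist x y)"
        using infdist_triangle[of y K x] \<kappa>(1) by (intro mult_left_mono) (auto simp: dist_commute)
      finally show "(infdist x F - \<kappa> * infdist x K) / (\<kappa> + 1) \<le> dist x y"
        using infdist_triangle[of x F y] \<kappa>(1) by (simp add: field_simps)
    qed (use span_zero in blast)
    then show ?thesis
      using \<kappa>(1) by (simp add: field_simps)
  qed
  with \<kappa>(1) show thesis by (rule that)
qed

lemma amenable_dual_cone_inner_ge:
  assumes K: "amenable K" and F: "cone_face F K" and z: "z \<in> dual_cone F"
  obtains M where "0 < M"
    "\<And>x \<epsilon>. infdist x K \<le> \<epsilon> \<Longrightarrow> infdist x (span F) \<le> \<epsilon> \<Longrightarrow> - M * \<epsilon> \<le> x \<bullet> z"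
proof -
  obtain \<kappa> where \<kappa>: "0 < \<kappa>"
    "\<And>x. infdist x F \<le> \<kappa> * infdist x K + (\<kappa> + 1) * infdist x (span F)"
    using amenable_infdist_face_le[OF K F] by blast
  \<comment> \<open>With both distances at most \<epsilon>, the two coefficients \<kappa> and
    \<kappa> + 1 add up to 2\<kappa> + 1. The final summand keeps \<open>M\<close> positive when
    \<open>z = 0\<close>.\<close>
  define M where "M = norm z * (2 * \<kappa> + 1) + 1"
  show thesis
  proof
    show "0 < M"
      unfolding M_def using \<kappa>(1) by (intro add_nonneg_pos mult_nonneg_nonneg) auto
  next
    fix x \<epsilon> assume \<epsilon>: "infdist x K \<le> \<epsilon>" "infdist x (span F) \<le> \<epsilon>"
    have "0 \<le> \<epsilon>"
      using \<epsilon>(1) infdist_nonneg[of x K] by simp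
    have "infdist x F \<le> \<kappa> * \<epsilon> + (\<kappa> + 1) * \<epsilon>"
      using \<kappa>(1) \<epsilon> by (intro order_trans[OF \<kappa>(2)[of x]] add_mono mult_left_mono) auto
    then have "norm z * infdist x F \<le> norm z * ((2 * \<kappa> + 1) * \<epsilon>)"
      by (intro mult_left_mono) (auto simp: algebra_simps)
    also have "\<dots> \<le> M * \<epsilon>"
      using \<open>0 \<le> \<epsilon>\<close> by (simp add: M_def algebra_simps)
    finally show "- M * \<epsilon> \<le> x \<bullet> z"
      using dual_cone_inner_ge[OF z, of x] F convex_cone_nonempty[of F]
      by (simp add: cone_face_def)
  qed
qed

section \<open>Faces of products and of linear images\<close>

lemma mem_orthogonal_comp_singleton: "x \<in> {z}\<^sup>\<bottom> \<longleftrightarrow> x \<bullet> z = 0"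
  by (simp add: orthogonal_comp_def orthogonal_def inner_commute)

lemma cone_face_zero: "cone_face F K \<Longrightarrow> 0 \<in> F"
  by (simp add: cone_face_def convex_cone_contains_0)

text \<open>Since both cones contain 0, a member \<open>(a, b)\<close> of the face is the sum of
  \<open>(a, 0)\<close> and \<open>(0, b)\<close> in the product cone, so the face contains both. It
  is therefore the product of its two projections.\<close>

lemma cone_face_TimesE:
  assumes K: "convex_cone K1" "convex_cone K2" and F: "cone_face F (K1 \<times> K2)"
  obtains F1 F2 where "cone_face F1 K1" "cone_face F2 K2" "F = F1 \<times> F2"
proof -
  have zero: "0 \<in> K1" "0 \<in> K2"
    using K convex_cone_contains_0 by auto
  have F_conv: "convex_cone F" and F_sub: "F \<subseteq> K1 \<times> K2"
    and F_face: "\<And>x y. x \<in> K1 \<times> K2 \<Longrightarrow> y \<in> K1 \<times> K2 \<Longrightarrow> x + y \<in> F \<Longrightarrow> x \<in> F \<and> y \<in> F"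
    using F unfolding cone_face_def by blast+
  have split: "(a, 0) \<in> F \<and> (0, b) \<in> F" if "(a, b) \<in> F" for a b
    using F_face[of "(a, 0)" "(0, b)"] F_sub zero that by auto
  have join: "(a, b) \<in> F" if "(a, b') \<in> F" "(a', b) \<in> F" for a b a' b'
    using convex_cone_add[OF F_conv, of "(a, 0)" "(0, b)"] split that by auto
  have "cone_face (fst ` F) K1"
    unfolding cone_face_def
  proof (intro conjI ballI impI)
    show "convex_cone (fst ` F)"
      by (rule convex_cone_linear_image[OF conjI[OF F_conv linear_fst]])
    fix x y assume "x \<in> K1" "y \<in> K1" "x + y \<in> fst ` F"
    \<comment> \<open>By \<open>split\<close> the sum of these two pairs, \<open>(x + y, 0)\<close>,
      lies in \<open>F\<close>, so the face property applies.\<close>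
    then have "(x, 0) \<in> F \<and> (y, 0) \<in> F"
      using split zero by (intro F_face) auto
    then show "x \<in> fst ` F" "y \<in> fst ` F"
      by force+
  qed (use F_sub in auto)
  moreover have "cone_face (snd ` F) K2"
    unfolding cone_face_def
  proof (intro conjI ballI impI)
    show "convex_cone (snd ` F)"
      by (rule convex_cone_linear_image[OF conjI[OF F_conv linear_snd]])
    fix x y assume "x \<in> K2" "y \<in> K2" "x + y \<in> snd ` F"
    then have "(0, x) \<in> F \<and> (0, y) \<in> F"
      using split zero by (intro F_face) auto
    then show "x \<in> snd ` F" "y \<in> snd ` F"
      by force+
  qed (use F_sub in auto)
  moreover have "F = fst ` F \<times> snd ` F"
    using join by force
  ultimately show thesis by (rule that)
qed

text \<open>Testing against pairs with one component 0 separates the two conditions.\<close>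

lemma dual_cone_Times_iff:
  assumes "0 \<in> F1" "0 \<in> F2"
  shows "(z1, z2) \<in> dual_cone (F1 \<times> F2) \<longleftrightarrow> z1 \<in> dual_cone F1 \<and> z2 \<in> dual_cone F2"
proof
  assume z: "(z1, z2) \<in> dual_cone (F1 \<times> F2)"
  have "0 \<le> z1 \<bullet> y1 + z2 \<bullet> y2" if "y1 \<in> F1" "y2 \<in> F2" for y1 y2
    using z that by (auto simp: dual_cone_def)
  from this[OF _ assms(2)] this[OF assms(1)]
  show "z1 \<in> dual_cone F1 \<and> z2 \<in> dual_cone F2"
    by (simp add: dual_cone_def)
qed (auto simp: dual_cone_def)

lemma cone_face_linear_image:
  assumes A: "linear A" "inj A" and F: "cone_face F K"
  shows "cone_face (A ` F) (A ` K)"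
  unfolding cone_face_def
proof (intro conjI ballI impI)
  show "convex_cone (A ` F)"
    using A F by (intro convex_cone_linear_image) (auto simp: cone_face_def)
  show "A ` F \<subseteq> A ` K"
    using F by (auto simp: cone_face_def)
  fix u v assume "u \<in> A ` K" "v \<in> A ` K" "u + v \<in> A ` F"
  then obtain x y where xy: "x \<in> K" "y \<in> K" "u = A x" "v = A y" "A (x + y) \<in> A ` F"
    by (auto simp: linear_add[OF A(1)])
  then have "x \<in> F \<and> y \<in> F"
    using F by (auto simp: cone_face_def inj_image_mem_iff[OF A(2)])
  then show "u \<in> A ` F" "v \<in> A ` F"
    using xy by auto
qed

section \<open>Finite-dimensional inner product spaces\<close>

text \<open>Finite dimension is given as a finite spanning set; orthogonalising it yields explicit
  coordinates. The remainder of the expansion is orthogonal to a spanning set, hence to itself,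
  hence zero.\<close>

lemma finite_span_orthogonal_expansion:
  assumes "\<exists>B :: 'a::real_inner set. finite B \<and> span B = UNIV"
  obtains C :: "'a::real_inner set" where "finite C" "\<And>x. x = (\<Sum>c\<in>C. (x \<bullet> c / (c \<bullet> c)) *\<^sub>R c)"
proof -
  obtain C :: "'a set" where C: "finite C" "span C = UNIV" "pairwise orthogonal C"
    using assms basis_orthogonal by metis
  have "x = (\<Sum>c\<in>C. (x \<bullet> c / (c \<bullet> c)) *\<^sub>R c)" for x
  proof -
    define r where "r = x - (\<Sum>c\<in>C. (x \<bullet> c / (c \<bullet> c)) *\<^sub>R c)"
    have "r \<bullet> d = 0" if d: "d \<in> C" for d
    proof -
      \<comment> \<open>This also covers \<open>d = 0\<close>, where division by zero gives 0 and
        \<open>x \<bullet> d\<close> vanishes as well.\<close>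
      have "(\<Sum>c\<in>C. (x \<bullet> c / (c \<bullet> c)) * (c \<bullet> d)) = (\<Sum>c\<in>C. if c = d then x \<bullet> d else 0)"
        using C(3) d by (intro sum.cong refl) (auto simp: pairwise_def orthogonal_def)
      then show ?thesis
        using C(1) d by (simp add: r_def inner_diff_left inner_sum_left)
    qed
    then have "C \<subseteq> {y. orthogonal r y}"
      by (auto simp: orthogonal_def)
    then have "span C \<subseteq> {y. orthogonal r y}"
      by (rule span_minimal[OF _ subspace_orthogonal_to_vector])
    then have "orthogonal r r"
      using C(2) by auto
    then show ?thesis
      by (simp add: orthogonal_self r_def)
  qed
  with C(1) show thesis by (rule that)
qed

text \<open>In coordinates \<open>f\<close> is a finite sum of maps, each a bounded functional times
  a fixed vector.\<close>

lemma finite_span_linear_bounded: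
  fixes f :: "'a::real_inner \<Rightarrow> 'b::real_normed_vector"
  assumes "\<exists>B :: 'a set. finite B \<and> span B = UNIV" and f: "linear f"
  shows "bounded_linear f"
proof -
  obtain C :: "'a set" where C: "finite C" "\<And>x. x = (\<Sum>c\<in>C. (x \<bullet> c / (c \<bullet> c)) *\<^sub>R c)"
    using finite_span_orthogonal_expansion[OF assms(1)] by blast
  have "f = (\<lambda>x. \<Sum>c\<in>C. (x \<bullet> c / (c \<bullet> c)) *\<^sub>R f c)"
  proof
    show "f x = (\<Sum>c\<in>C. (x \<bullet> c / (c \<bullet> c)) *\<^sub>R f c)" for x
      by (subst C(2)[of x]) (simp add: linear_sum[OF f] linear_scale[OF f])
  qed
  moreover have "bounded_linear (\<lambda>x. \<Sum>c\<in>C. (x \<bullet> c / (c \<bullet> c)) *\<^sub>R f c)"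
    unfolding divide_inverse
    by (intro bounded_linear_sum bounded_linear_scaleR_const bounded_linear_mult_const
        bounded_linear_inner_left)
  ultimately show ?thesis by simp
qed

text \<open>\<open>adjoint\<close> is defined by choice, so its characteristic equation holds once
  some map satisfies it. The coordinate expansion supplies one, with coefficients
  \<open>f c \<bullet> y / (c \<bullet> c)\<close>.\<close>

lemma finite_span_adjoint_works:
  fixes f :: "'a::real_inner \<Rightarrow> 'b::real_inner"
  assumes "\<exists>B :: 'a set. finite B \<and> span B = UNIV" and f: "linear f"
  shows "f x \<bullet> y = x \<bullet> adjoint f y"
proof -
  obtain C :: "'a set" where C: "finite C" "\<And>x. x = (\<Sum>c\<in>C. (x \<bullet> c / (c \<bullet> c)) *\<^sub>R c)"
    using finite_span_orthogonal_expansion[OF assms(1)] by blast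
  have "f x \<bullet> y = x \<bullet> (\<Sum>c\<in>C. (f c \<bullet> y / (c \<bullet> c)) *\<^sub>R c)" for x y
    by (subst C(2)[of x])
      (simp add: linear_sum[OF f] linear_scale[OF f] inner_sum_left inner_sum_right mult.commute)
  then have "\<exists>f'. \<forall>x y. f x \<bullet> y = x \<bullet> f' y"
    by (intro exI allI)
  then have "\<forall>x y. f x \<bullet> y = x \<bullet> adjoint f y"
    unfolding adjoint_def by (rule someI_ex)
  then show ?thesis by blast
qed

section \<open>Facial residual functions\<close>

text \<open>Projections are 1-Lipschitz, so the components inherit the distance bounds with the same
  \<epsilon>, and their norms do not exceed that of the pair. Only the inner product bounds worsen,
  by a constant factor, so only the first argument is rescaled.\<close>

lemma facial_residual_function_Times:
  assumes K1: "amenable K1" and K2: "amenable K2"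
    and F: "cone_face (F1 \<times> F2) (K1 \<times> K2)" "(z1, z2) \<in> dual_cone (F1 \<times> F2)"
    and \<psi>1: "facial_residual_function K1 F1 z1 \<psi>1"
    and \<psi>2: "facial_residual_function K2 F2 z2 \<psi>2"
  obtains M where "0 < M"
    "facial_residual_function (K1 \<times> K2) (F1 \<times> F2) (z1, z2) (\<lambda>\<epsilon> t. \<psi>1 (M * \<epsilon>) t + \<psi>2 (M * \<epsilon>) t)"
proof -
  have F1: "cone_face F1 K1" "z1 \<in> dual_cone F1" and F2: "cone_face F2 K2" "z2 \<in> dual_cone F2"
    and K: "closed K1" "convex_cone K1" "closed K2" "convex_cone K2"
    using \<psi>1 \<psi>2 by (simp_all add: facial_residual_function_def)
  \<comment> \<open>Monotonicity in the second argument replaces \<open>norm x\<close> by any upper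
    bound \<open>t\<close>; later \<open>t\<close> is the norm of the whole pair.\<close>
  have res1: "infdist x (F1 \<inter> {z1}\<^sup>\<bottom>) \<le> \<psi>1 \<epsilon> t"
    if "x \<in> span K1" "0 \<le> \<epsilon>" "infdist x K1 \<le> \<epsilon>" "x \<bullet> z1 \<le> \<epsilon>" "infdist x (span F1) \<le> \<epsilon>" "norm x \<le> t"
    for x \<epsilon> t
    using \<psi>1 that unfolding facial_residual_function_def by (meson norm_ge_zero order_trans)
  have res2: "infdist x (F2 \<inter> {z2}\<^sup>\<bottom>) \<le> \<psi>2 \<epsilon> t"
    if "x \<in> span K2" "0 \<le> \<epsilon>" "infdist x K2 \<le> \<epsilon>" "x \<bullet> z2 \<le> \<epsilon>" "infdist x (span F2) \<le> \<epsilon>" "norm x \<le> t"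
    for x \<epsilon> t
    using \<psi>2 that unfolding facial_residual_function_def by (meson norm_ge_zero order_trans)
  note zero = cone_face_zero[OF F1(1)] cone_face_zero[OF F2(1)]
    convex_cone_contains_0[OF K(2)] convex_cone_contains_0[OF K(4)]
  obtain M1 where M1: "0 < M1"
    "\<And>x \<epsilon>. infdist x K1 \<le> \<epsilon> \<Longrightarrow> infdist x (span F1) \<le> \<epsilon> \<Longrightarrow> - M1 * \<epsilon> \<le> x \<bullet> z1"
    using amenable_dual_cone_inner_ge[OF K1 F1] by blast
  obtain M2 where M2: "0 < M2"
    "\<And>x \<epsilon>. infdist x K2 \<le> \<epsilon> \<Longrightarrow> infdist x (span F2) \<le> \<epsilon> \<Longrightarrow> - M2 * \<epsilon> \<le> x \<bullet> z2"
    using amenable_dual_cone_inner_ge[OF K2 F2] by blast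
  \<comment> \<open>The bound on the sum of the inner products gives \<open>x1 \<bullet> z1 \<le>
    \<epsilon> - x2 \<bullet> z2 \<le> (1 + M2) * \<epsilon>\<close>, and symmetrically with
    \<open>M1\<close>. This \<open>M\<close> dominates both factors and 1.\<close>
  define M where "M = 1 + M1 + M2"
  have M: "0 < M" using M1 M2 by (simp add: M_def)
  have residual: "infdist x ((F1 \<times> F2) \<inter> {(z1, z2)}\<^sup>\<bottom>)
      \<le> \<psi>1 (M * \<epsilon>) (norm x) + \<psi>2 (M * \<epsilon>) (norm x)"
    if x: "x \<in> span (K1 \<times> K2)" and \<epsilon>: "0 \<le> \<epsilon>" "infdist x (K1 \<times> K2) \<le> \<epsilon>" "x \<bullet> (z1, z2) \<le> \<epsilon>"
      "infdist x (span (F1 \<times> F2)) \<le> \<epsilon>" for x \<epsilon>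
  proof -
    obtain x1 x2 where x12: "x = (x1, x2)" by fastforce
    have fst_span: "fst ` span (S \<times> T) \<subseteq> span S" for S :: "'a set" and T :: "'b set"
      unfolding linear_span_image[OF linear_fst, symmetric] by (intro span_mono) auto
    have snd_span: "snd ` span (S \<times> T) \<subseteq> span T" for S :: "'a set" and T :: "'b set"
      unfolding linear_span_image[OF linear_snd, symmetric] by (intro span_mono) auto
    have fst_image_le: "fst ` (K1 \<times> K2) \<subseteq> K1" and snd_image_le: "snd ` (K1 \<times> K2) \<subseteq> K2"
      by auto
    have ne: "K1 \<times> K2 \<noteq> {}" "span (F1 \<times> F2) \<noteq> {}"
      using zero span_zero[of "F1 \<times> F2"] by auto
    have d1: "infdist x1 K1 \<le> \<epsilon>" "infdist x1 (span F1) \<le> \<epsilon>"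
      using infdist_fst_le[OF ne(1) fst_image_le, of x] infdist_fst_le[OF ne(2) fst_span, of x] \<epsilon>
      by (auto simp: x12)
    have d2: "infdist x2 K2 \<le> \<epsilon>" "infdist x2 (span F2) \<le> \<epsilon>"
      using infdist_snd_le[OF ne(1) snd_image_le, of x] infdist_snd_le[OF ne(2) snd_span, of x] \<epsilon>
      by (auto simp: x12)
    have "0 \<le> M1 * \<epsilon>" "0 \<le> M2 * \<epsilon>"
      using M1 M2 \<epsilon>(1) by auto
    moreover have "- M1 * \<epsilon> \<le> x1 \<bullet> z1" "- M2 * \<epsilon> \<le> x2 \<bullet> z2"
      using M1(2)[OF d1] M2(2)[OF d2] .
    ultimately have inner: "x1 \<bullet> z1 \<le> M * \<epsilon>" "x2 \<bullet> z2 \<le> M * \<epsilon>" and "\<epsilon> \<le> M * \<epsilon>"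
      using \<epsilon>(1,3) by (simp_all add: x12 M_def algebra_simps)
    \<comment> \<open>Componentwise orthogonality implies orthogonality to the pair, and distance
      can only grow on passing to a smaller nonempty set; 0 witnesses nonemptiness.\<close>
    have "infdist x ((F1 \<times> F2) \<inter> {(z1, z2)}\<^sup>\<bottom>)
        \<le> infdist x ((F1 \<inter> {z1}\<^sup>\<bottom>) \<times> (F2 \<inter> {z2}\<^sup>\<bottom>))"
      using zero
      by (intro infdist_mono) (auto simp: mem_orthogonal_comp_singleton)
    also have "\<dots> \<le> infdist x1 (F1 \<inter> {z1}\<^sup>\<bottom>) + infdist x2 (F2 \<inter> {z2}\<^sup>\<bottom>)"
      unfolding x12 using zero
      by (intro infdist_Times_le) (auto simp: mem_orthogonal_comp_singleton intro!: exI[of _ 0])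
    also have "\<dots> \<le> \<psi>1 (M * \<epsilon>) (norm x) + \<psi>2 (M * \<epsilon>) (norm x)"
    proof (intro add_mono res1 res2)
      show "x1 \<in> span K1" "x2 \<in> span K2"
        using fst_span snd_span x by (force simp: x12)+
      show "norm x1 \<le> norm x" "norm x2 \<le> norm x"
        by (simp_all add: x12 norm_fst_le norm_snd_le)
    qed (use d1 d2 inner \<open>\<epsilon> \<le> M * \<epsilon>\<close> \<epsilon>(1) M in auto)
    finally show ?thesis .
  qed
  have "facial_residual_function (K1 \<times> K2) (F1 \<times> F2) (z1, z2)
      (\<lambda>\<epsilon> t. \<psi>1 (M * \<epsilon>) t + \<psi>2 (M * \<epsilon>) t)"
    unfolding facial_residual_function_def
  proof (intro conjI allI ballI impI; (elim conjE)?)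
    fix \<epsilon> t :: real assume "0 \<le> \<epsilon>" "0 \<le> t"
    then show "0 \<le> \<psi>1 (M * \<epsilon>) t + \<psi>2 (M * \<epsilon>) t"
      using \<psi>1 \<psi>2 M by (simp add: facial_residual_function_def)
  next
    fix \<epsilon> \<epsilon>' t :: real assume "0 \<le> \<epsilon>" "\<epsilon> \<le> \<epsilon>'" "0 \<le> t"
    then show "\<psi>1 (M * \<epsilon>) t + \<psi>2 (M * \<epsilon>) t \<le> \<psi>1 (M * \<epsilon>') t + \<psi>2 (M * \<epsilon>') t"
      using \<psi>1 \<psi>2 M by (intro add_mono) (auto simp: facial_residual_function_def)
  next
    fix \<epsilon> t t' :: real assume "0 \<le> \<epsilon>" "0 \<le> t" "t \<le> t'"
    then show "\<psi>1 (M * \<epsilon>) t + \<psi>2 (M * \<epsilon>) t \<le> \<psi>1 (M * \<epsilon>) t' + \<psi>2 (M * \<epsilon>) t'"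
      using \<psi>1 \<psi>2 M by (intro add_mono) (auto simp: facial_residual_function_def)
  next
    fix t :: real assume "0 \<le> t"
    then show "\<psi>1 (M * 0) t + \<psi>2 (M * 0) t = 0"
      using \<psi>1 \<psi>2 by (simp add: facial_residual_function_def)
  qed (use K F residual in \<open>auto intro: closed_Times convex_cone_Times\<close>)
  with M show thesis by (rule that)
qed

text \<open>A Lipschitz left inverse of \<open>A\<close> carries the hypotheses back to
  \<open>K\<close>, which rescales both arguments by \<open>M\<close>; the Lipschitz constant
  \<open>L\<close> of \<open>A\<close> carries the conclusion forward. The adjoint identity matches
  the two orthogonality conditions.\<close>

lemma facial_residual_function_linear_image:
  fixes A :: "'a::real_inner \<Rightarrow> 'b::real_inner"
  assumes fin: "\<exists>B :: 'a set. finite B \<and> span B = UNIV" "\<exists>B :: 'b set. finite B \<and> span B = UNIV"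
    and A: "linear A" "inj A" and z: "z \<in> dual_cone (A ` F)"
    and \<psi>: "facial_residual_function K F (adjoint A z) \<psi>"
  obtains L M where "0 < L" "0 < M"
    "facial_residual_function (A ` K) (A ` F) z (\<lambda>\<epsilon> t. L * \<psi> (M * \<epsilon>) (M * t))"
proof -
  have F: "cone_face F K" and K: "closed K" "convex_cone K"
    using \<psi> by (simp_all add: facial_residual_function_def)
  have res: "infdist x (F \<inter> {adjoint A z}\<^sup>\<bottom>) \<le> \<psi> \<epsilon> t"
    if "x \<in> span K" "0 \<le> \<epsilon>" "infdist x K \<le> \<epsilon>" "x \<bullet> adjoint A z \<le> \<epsilon>" "infdist x (span F) \<le> \<epsilon>"
      "norm x \<le> t" for x \<epsilon> t
    using \<psi> that unfolding facial_residual_function_def by (meson norm_ge_zero order_trans)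
  note adj = finite_span_adjoint_works[OF fin(1) A(1)]
  have zero: "0 \<in> F" "0 \<in> K"
    using cone_face_zero[OF F] convex_cone_contains_0[OF K(2)] .
  obtain g where g: "linear g" "g \<circ> A = id"
    using linear_injective_left_inverse[OF A] by blast
  then have gA: "g (A x) = x" for x
    by (metis comp_apply id_apply)
  have blA: "bounded_linear A" and blg: "bounded_linear g"
    using finite_span_linear_bounded fin A(1) g(1) by auto
  obtain L where L: "0 < L" "\<And>x. norm (A x) \<le> norm x * L"
    using bounded_linear.pos_bounded[OF blA] by blast
  obtain M0 where M0: "0 < M0" "\<And>x. norm (g x) \<le> norm x * M0"
    using bounded_linear.pos_bounded[OF blg] by blast
  \<comment> \<open>Besides being a Lipschitz constant for \<open>g\<close>, \<open>M\<close> must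
    be at least 1: the inner product is unchanged by the transfer, and its bound \<epsilon> has to
    be absorbed into \<open>M * \<epsilon>\<close>.\<close>
  define M where "M = M0 + 1"
  have M: "1 \<le> M" "norm (g y) \<le> M * norm y" for y
    using M0(1) M0(2)[of y] by (simp_all add: M_def algebra_simps add_increasing)
  have distA: "dist (A x) (A y) \<le> L * dist x y" for x y
    using L(2)[of "x - y"] by (simp add: dist_norm linear_diff[OF A(1)] mult.commute)
  have distg: "dist (g x) (g y) \<le> M * dist x y" for x y
    using M(2)[of "x - y"] by (simp add: dist_norm linear_diff[OF g(1)])
  have infdistg: "infdist x S \<le> M * infdist (A x) (A ` S)" if "S \<noteq> {}" for x S
    using infdist_lipschitz_image_le[of "A ` S" g S M "A x"] that M(1) distg[of "A x"]
    by (simp add: gA image_image)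
  \<comment> \<open>This describes the image by closed conditions: the fixed points of
    \<open>A \<circ> g\<close> form the range of \<open>A\<close>, and \<open>g\<close> recovers the
    preimage.\<close>
  have "A ` K = {y. A (g y) = y} \<inter> g -` K"
    by (force simp: gA)
  moreover have "continuous_on UNIV g" "continuous_on UNIV (\<lambda>y. A (g y))"
    using bounded_linear_compose[OF blA blg] blg by (simp_all add: linear_continuous_on)
  then have "closed {y. A (g y) = y}" "closed (g -` K)"
    using K(1) by (auto intro: closed_Collect_eq closed_vimage)
  ultimately have closed: "closed (A ` K)"
    by auto
  have residual: "infdist w (A ` F \<inter> {z}\<^sup>\<bottom>) \<le> L * \<psi> (M * \<epsilon>) (M * norm w)"
    if w: "w \<in> span (A ` K)" and \<epsilon>: "0 \<le> \<epsilon>" "infdist w (A ` K) \<le> \<epsilon>" "w \<bullet> z \<le> \<epsilon>"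
      "infdist w (span (A ` F)) \<le> \<epsilon>" for w \<epsilon>
  proof -
    obtain x where x: "x \<in> span K" "w = A x"
      using w by (auto simp: linear_span_image[OF A(1)])
    have "infdist w (A ` F \<inter> {z}\<^sup>\<bottom>) \<le> L * infdist x (F \<inter> {adjoint A z}\<^sup>\<bottom>)"
      unfolding x(2) using zero L(1) distA
      by (intro infdist_lipschitz_image_le)
        (auto simp: mem_orthogonal_comp_singleton adj intro!: exI[of _ 0])
    also have "\<dots> \<le> L * \<psi> (M * \<epsilon>) (M * norm w)"
    proof (intro mult_left_mono res)
      have scale: "d \<le> M * \<epsilon>" if "d \<le> M * e" "e \<le> \<epsilon>" for d e
        using that M(1) by (smt (verit) mult_left_mono)
      show "infdist x K \<le> M * \<epsilon>"
        using infdistg[of K x] zero \<epsilon>(2) by (intro scale) (auto simp: x(2))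
      show "infdist x (span F) \<le> M * \<epsilon>"
        using infdistg[of "span F" x] span_zero[of F] \<epsilon>(4)
        by (intro scale) (auto simp: x(2) linear_span_image[OF A(1)])
      have "\<epsilon> \<le> M * \<epsilon>"
        using mult_right_mono[OF M(1) \<epsilon>(1)] by simp
      then show "x \<bullet> adjoint A z \<le> M * \<epsilon>"
        using \<epsilon>(3) by (simp add: x(2) adj)
      show "norm x \<le> M * norm w"
        using M(2)[of w] by (simp add: x(2) gA)
    qed (use x L(1) M(1) \<epsilon>(1) in auto)
    finally show ?thesis .
  qed
  have "facial_residual_function (A ` K) (A ` F) z (\<lambda>\<epsilon> t. L * \<psi> (M * \<epsilon>) (M * t))"
    unfolding facial_residual_function_def
  proof (intro conjI allI ballI impI; (elim conjE)?)
    show "closed (A ` K)" "z \<in> dual_cone (A ` F)"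
      by fact+
    show "convex_cone (A ` K)"
      using K(2) A(1) by (simp add: convex_cone_linear_image)
    show "cone_face (A ` F) (A ` K)"
      by (rule cone_face_linear_image[OF A F])
  next
    fix \<epsilon> t :: real assume "0 \<le> \<epsilon>" "0 \<le> t"
    then show "0 \<le> L * \<psi> (M * \<epsilon>) (M * t)"
      using \<psi> L(1) M(1) by (simp add: facial_residual_function_def)
  next
    fix \<epsilon> \<epsilon>' t :: real assume "0 \<le> \<epsilon>" "\<epsilon> \<le> \<epsilon>'" "0 \<le> t"
    then show "L * \<psi> (M * \<epsilon>) (M * t) \<le> L * \<psi> (M * \<epsilon>') (M * t)"
      using \<psi> L(1) M(1) by (simp add: facial_residual_function_def)
  next
    fix \<epsilon> t t' :: real assume "0 \<le> \<epsilon>" "0 \<le> t" "t \<le> t'"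
    then show "L * \<psi> (M * \<epsilon>) (M * t) \<le> L * \<psi> (M * \<epsilon>) (M * t')"
      using \<psi> L(1) M(1) by (simp add: facial_residual_function_def)
  next
    fix t :: real assume "0 \<le> t"
    then show "L * \<psi> (M * 0) (M * t) = 0"
      using \<psi> M(1) by (simp add: facial_residual_function_def)
  qed (rule residual)
  with L(1) M(1) show thesis
    by (intro that) auto
qed

text \<open>Part (i) first asserts that a product decomposition exists and then treats every such
  decomposition, so the result does not depend on a choice of factors.\<close>

theorem proposition17:
  assumes "\<exists>B :: 'e1::real_inner set. finite B \<and> span B = UNIV"
    and "\<exists>B :: 'e2::real_inner set. finite B \<and> span B = UNIV"
    and "\<exists>B :: 'e::real_inner set. finite B \<and> span B = UNIV"
    and "\<exists>B :: 'f::real_inner set. finite B \<and> span B = UNIV"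
  shows
    "(\<forall>(K1 :: 'e1 set) (K2 :: 'e2 set) F z.
        amenable K1 \<and> pointed K1 \<and> amenable K2 \<and> pointed K2 \<and>
        cone_face F (K1 \<times> K2) \<and> z \<in> dual_cone F \<longrightarrow>
        (\<exists>F1 F2 z1 z2. cone_face F1 K1 \<and> cone_face F2 K2 \<and> F = F1 \<times> F2 \<and>
           z = (z1, z2) \<and> z1 \<in> dual_cone F1 \<and> z2 \<in> dual_cone F2) \<and>
        (\<forall>F1 F2 z1 z2 \<psi>1 \<psi>2.
           cone_face F1 K1 \<and> cone_face F2 K2 \<and> F = F1 \<times> F2 \<and>
           z = (z1, z2) \<and> z1 \<in> dual_cone F1 \<and> z2 \<in> dual_cone F2 \<and>
           facial_residual_function K1 F1 z1 \<psi>1 \<and> facial_residual_function K2 F2 z2 \<psi>2 \<longrightarrow>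
           (\<exists>\<phi>. positive_rescaling (\<lambda>\<epsilon> t. \<psi>1 \<epsilon> t + \<psi>2 \<epsilon> t) \<phi> \<and>
              facial_residual_function (K1 \<times> K2) F z \<phi>)))
     \<and>
     (\<forall>(K :: 'e set) (A :: 'e \<Rightarrow> 'f) F.
        closed K \<and> convex_cone K \<and> pointed K \<and> linear A \<and> inj A \<and> cone_face F K \<longrightarrow>
        cone_face (A ` F) (A ` K) \<and>
        (\<forall>z \<psi>. z \<in> dual_cone (A ` F) \<and> facial_residual_function K F (adjoint A z) \<psi> \<longrightarrow>
           (\<exists>\<phi>. positive_rescaling \<psi> \<phi> \<and>
              facial_residual_function (A ` K) (A ` F) z \<phi>)))"
proof (intro conjI allI impI; elim conjE)
  fix K1 :: "'e1 set" and K2 :: "'e2 set" and F z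
  assume K: "amenable K1" "amenable K2"
    and F: "cone_face F (K1 \<times> K2)" and z: "z \<in> dual_cone F"
  obtain F1 F2 where F12: "cone_face F1 K1" "cone_face F2 K2" "F = F1 \<times> F2"
    using cone_face_TimesE[OF _ _ F] K by (auto simp: amenable_def)
  obtain z1 z2 where z12: "z = (z1, z2)"
    by (cases z)
  have "z1 \<in> dual_cone F1 \<and> z2 \<in> dual_cone F2"
    using z dual_cone_Times_iff[OF F12(1,2)[THEN cone_face_zero]] by (simp add: F12(3) z12)
  with F12 z12 show "\<exists>F1 F2 z1 z2. cone_face F1 K1 \<and> cone_face F2 K2 \<and> F = F1 \<times> F2 \<and>
      z = (z1, z2) \<and> z1 \<in> dual_cone F1 \<and> z2 \<in> dual_cone F2"
    by (intro exI conjI) auto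
next
  fix K1 :: "'e1 set" and K2 :: "'e2 set" and F z F1 F2 z1 z2 \<psi>1 \<psi>2
  assume K: "amenable K1" "amenable K2"
    and F: "cone_face F (K1 \<times> K2)" "z \<in> dual_cone F"
    and eq: "F = F1 \<times> F2" "z = (z1, z2)"
    and \<psi>: "facial_residual_function K1 F1 z1 \<psi>1" "facial_residual_function K2 F2 z2 \<psi>2"
  obtain M where M: "0 < M"
    "facial_residual_function (K1 \<times> K2) F z (\<lambda>\<epsilon> t. \<psi>1 (M * \<epsilon>) t + \<psi>2 (M * \<epsilon>) t)"
    using facial_residual_function_Times[OF K F[unfolded eq] \<psi>] unfolding eq by blast
  \<comment> \<open>The rescaling constants are \<open>M\<close> for the first argument and 1 for
    the second argument and the value.\<close>
  have "positive_rescaling (\<lambda>\<epsilon> t. \<psi>1 \<epsilon> t + \<psi>2 \<epsilon> t) (\<lambda>\<epsilon> t. \<psi>1 (M * \<epsilon>) t + \<psi>2 (M * \<epsilon>) t)"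
    unfolding positive_rescaling_def
    by (rule exI[of _ M], simp add: M(1), rule exI[of _ 1], simp, rule exI[of _ 1], simp)
  with M(2) show "\<exists>\<phi>. positive_rescaling (\<lambda>\<epsilon> t. \<psi>1 \<epsilon> t + \<psi>2 \<epsilon> t) \<phi> \<and>
      facial_residual_function (K1 \<times> K2) F z \<phi>"
    by blast
next
  fix K :: "'e set" and A :: "'e \<Rightarrow> 'f" and F
  assume "linear A" "inj A" "cone_face F K"
  then show "cone_face (A ` F) (A ` K)"
    by (rule cone_face_linear_image)
next
  fix K :: "'e set" and A :: "'e \<Rightarrow> 'f" and F z \<psi>
  assume A: "linear A" "inj A" and z: "z \<in> dual_cone (A ` F)"
    and \<psi>: "facial_residual_function K F (adjoint A z) \<psi>"
  obtain L M where "0 < L" "0 < M"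
    and \<phi>: "facial_residual_function (A ` K) (A ` F) z (\<lambda>\<epsilon> t. L * \<psi> (M * \<epsilon>) (M * t))"
    using facial_residual_function_linear_image[OF assms(3,4) A z \<psi>] by blast
  then have "positive_rescaling \<psi> (\<lambda>\<epsilon> t. L * \<psi> (M * \<epsilon>) (M * t))"
    unfolding positive_rescaling_def by blast
  with \<phi> show "\<exists>\<phi>. positive_rescaling \<psi> \<phi> \<and> facial_residual_function (A ` K) (A ` F) z \<phi>"
    by blast
qed

end
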